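(* Let $\alpha\ge1$ and consider a dissipative flow network $\mathcal{G}=(\mathcal{V},\mathcal{E})$ with dissipation functions $f_{ij}(x)=\mathrm{sgn}(x)|x|^\alpha$ on every edge, parameters $b_{ij}\in\mathbb{R}$, cost coefficients $(c_i)_{i\in\mathcal{V}}$, and potential bounds $\underline{\pi}_i\le\overline{\pi}_i$. Introduce for each $(i,j)\in\mathcal{E}$ a binary variable $s_{ij}\in\{-1,1\}$ denoting the flow direction, $s_{ij}\phi_{ij}\ge0$, so that the potential drop relation $\pi_i-\pi_j=f_{ij}(\phi_{ij})-b_{ij}$ reads $\pi_i-\pi_j+b_{ij}=s_{ij}|\phi_{ij}|^\alpha$, equivalently $s_{ij}(\pi_i-\pi_j+b_{ij})=|\phi_{ij}|^\alpha$. Consider the pair of inequalities, for $(i,j)\in\mathcal{E}$, $$|\phi_{ij}|^\alpha\le s_{ij}(\overline{\pi}_i-\underline{\pi}_j)-(\pi_i-\pi_j)+(\overline{\pi}_i-\underline{\pi}_j),\qquad|\phi_{ij}|^\alpha\le s_{ij}(\underline{\pi}_i-\overline{\pi}_j)+(\pi_i-\pi_j)-(\underline{\pi}_i-\overline{\pi}_j).\quad(\mathrm{C})$$ Then: (i) The inequalities (C) with $s_{ij}\in\{-1,1\}$ are mixed integer convex constraints. (ii) The pair (C), obtained by applying the McCormick relaxation to the bilinear term $s_{ij}(\pi_i-\pi_j+b_{ij})$ and relaxing the equality to an inequality, is a relaxation of the potential drop relation. Since the McCormick relaxation is tight when one of the variables is binary, the only relaxation in this set of constraints is the replacement of the equality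 by an inequality, i.e. for $s_{ij}\in\{-1,1\}$ and potentials within their bounds, (C) is equivalent to $|\phi_{ij}|^\alpha\le s_{ij}(\pi_i-\pi_j+b_{ij})$. (iii) Consequently, replacing the potential drop relations by (C) with $s_{ij}\in\{-1,1\}$ in the maximum throughput problem $$\min_{x,\phi,\pi}\ \sum_{i\in\mathcal{V}}c_ix_i\ \ \text{s.t.}\ \ \sum_{j\in\partial i}\phi_{ij}=x_i\ \forall i\in\mathcal{V},\ \ \pi_i-\pi_j=f_{ij}(\phi_{ij})-b_{ij}\ \forall(i,j)\in\mathcal{E},\ \ \underline{\pi}_i\le\pi_i\le\overline{\pi}_i\ \forall i\in\mathcal{V}$$ gives a mixed integer convex relaxation of that problem, whose optimal value is a lower bound on the optimal value of the maximum throughput problem.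
   Context: A dissipative flow network consists of a finite connected undirected graph $\mathcal{G}=(\mathcal{V},\mathcal{E})$ in which each edge has a fixed nominal orientation $i\to j$, written $(i,j)\in\mathcal{E}$ (each edge appears in $\mathcal{E}$ once). Each edge carries a flow $\phi_{ij}\in\mathbb{R}$ with $\phi_{ji}=-\phi_{ij}$ and a parameter $b_{ij}\in\mathbb{R}$; each node carries a potential $\pi_i\in\mathbb{R}$ and has injection $x_i\in\mathbb{R}$. $\partial i$ is the set of neighbours of $i$. The McCormick relaxation of a product of two bounded variables replaces it by the linear inequalities describing its convex and concave envelopes over the box of bounds.
   Formalization: In (C) the coefficients of s_ij are corrected by adding b_ij, as the McCormick relaxation of s_ij(π_i−π_j+b_ij) gives; the displayed pair without b_ij makes (ii) false when b_ij≠0 (e.g. all bounds and potentials 0, b=φ=s=1) and is the case b_ij=0. *)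

theory Defs
  imports "HOL-Analysis.Analysis"
begin

text \<open>
  The vertex set is the finite type \<open>'v\<close>; \<open>E\<close> holds each edge once, in its nominal orientation, so
  asymmetry of \<open>E\<close> excludes loops and opposite copies of an edge.
\<close>

definition flow_network :: "('v::finite \<times> 'v) set \<Rightarrow> bool" where
  "flow_network E \<longleftrightarrow> asym E \<and> (\<forall>i j. (i, j) \<in> (E \<union> E\<inverse>)\<^sup>*)"

definition neighbours :: "('v::finite \<times> 'v) set \<Rightarrow> 'v \<Rightarrow> 'v set" where
  "neighbours E i = {j. (i, j) \<in> E \<or> (j, i) \<in> E}"

text \<open>
  Quantities attached to edges are matrices of which only the entries at \<open>(i, j) \<in> E\<close> are ever used;
  the flow against the nominal orientation is the negative of the stored one.
\<close>

definition flow :: "('v::finite \<times> 'v) set \<Rightarrow> real^'v^'v \<Rightarrow> 'v \<Rightarrow> 'v \<Rightarrow> real" where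
  "flow E \<phi> i j = (if (i, j) \<in> E then \<phi> $ i $ j else - \<phi> $ j $ i)"

definition dissipation :: "real \<Rightarrow> real \<Rightarrow> real" where
  "dissipation \<alpha> x = sgn x * \<bar>x\<bar> powr \<alpha>"

definition flow_balance :: "('v::finite \<times> 'v) set \<Rightarrow> real^'v^'v \<Rightarrow> real^'v \<Rightarrow> bool" where
  "flow_balance E \<phi> x \<longleftrightarrow> (\<forall>i. (\<Sum>j\<in>neighbours E i. flow E \<phi> i j) = x $ i)"

definition potential_drop ::
  "('v \<Rightarrow> 'v \<Rightarrow> real \<Rightarrow> real) \<Rightarrow> real^'v^'v \<Rightarrow> real^'v^'v \<Rightarrow> real^'v \<Rightarrow> 'v::finite \<Rightarrow> 'v \<Rightarrow> bool" where
  "potential_drop f b \<phi> \<pi> i j \<longleftrightarrow> \<pi> $ i - \<pi> $ j = f i j (\<phi> $ i $ j) - b $ i $ j"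

definition within_bounds :: "real^'v \<Rightarrow> real^'v \<Rightarrow> real^'v::finite \<Rightarrow> bool" where
  "within_bounds lo hi \<pi> \<longleftrightarrow> (\<forall>i. lo $ i \<le> \<pi> $ i \<and> \<pi> $ i \<le> hi $ i)"

definition cost :: "real^'v \<Rightarrow> real^'v::finite \<Rightarrow> real" where
  "cost c x = (\<Sum>i\<in>UNIV. c $ i * x $ i)"

definition max_throughput_feasible ::
  "('v \<Rightarrow> 'v \<Rightarrow> real \<Rightarrow> real) \<Rightarrow> ('v \<times> 'v) set \<Rightarrow> real^'v^'v \<Rightarrow> real^'v \<Rightarrow> real^'v
     \<Rightarrow> ((real^'v::finite) \<times> (real^'v^'v) \<times> (real^'v)) set" where
  "max_throughput_feasible f E b lo hi =
     {(x, \<phi>, \<pi>). flow_balance E \<phi> x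
        \<and> (\<forall>(i, j)\<in>E. potential_drop f b \<phi> \<pi> i j)
        \<and> within_bounds lo hi \<pi>}"

text \<open>
  The upper McCormick inequalities for \<open>s * (\<pi>\<^sub>i - \<pi>\<^sub>j + b\<^sub>i\<^sub>j)\<close> with \<open>s \<in> [-1, 1]\<close> have
  \<open>b\<^sub>i\<^sub>j\<close> in the coefficient of \<open>s\<close>.  The pair written without it is the
  case \<open>b\<^sub>i\<^sub>j = 0\<close>; with another \<open>b\<^sub>i\<^sub>j\<close> it can cut off points satisfying the
  potential drop relation; the two lemmas below record both facts.
\<close>

definition C_rhs1 ::
  "real^'v^'v \<Rightarrow> real^'v \<Rightarrow> real^'v \<Rightarrow> real^'v \<Rightarrow> real^'v^'v \<Rightarrow> 'v::finite \<Rightarrow> 'v \<Rightarrow> real" where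
  "C_rhs1 b lo hi \<pi> s i j =
     s $ i $ j * (hi $ i - lo $ j + b $ i $ j) - (\<pi> $ i - \<pi> $ j) + (hi $ i - lo $ j)"

definition C_rhs2 ::
  "real^'v^'v \<Rightarrow> real^'v \<Rightarrow> real^'v \<Rightarrow> real^'v \<Rightarrow> real^'v^'v \<Rightarrow> 'v::finite \<Rightarrow> 'v \<Rightarrow> real" where
  "C_rhs2 b lo hi \<pi> s i j =
     s $ i $ j * (lo $ i - hi $ j + b $ i $ j) + (\<pi> $ i - \<pi> $ j) - (lo $ i - hi $ j)"

definition C_pair ::
  "real \<Rightarrow> real^'v^'v \<Rightarrow> real^'v \<Rightarrow> real^'v \<Rightarrow> real^'v^'v \<Rightarrow> real^'v \<Rightarrow> real^'v^'v
     \<Rightarrow> 'v::finite \<Rightarrow> 'v \<Rightarrow> bool" where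
  "C_pair \<alpha> b lo hi \<phi> \<pi> s i j \<longleftrightarrow>
     \<bar>\<phi> $ i $ j\<bar> powr \<alpha> \<le> C_rhs1 b lo hi \<pi> s i j \<and>
     \<bar>\<phi> $ i $ j\<bar> powr \<alpha> \<le> C_rhs2 b lo hi \<pi> s i j"

lemma C_pair_no_shift:
  assumes "b $ i $ j = 0"
  shows "C_pair \<alpha> b lo hi \<phi> \<pi> s i j \<longleftrightarrow>
    \<bar>\<phi> $ i $ j\<bar> powr \<alpha>
      \<le> s $ i $ j * (hi $ i - lo $ j) - (\<pi> $ i - \<pi> $ j) + (hi $ i - lo $ j) \<and>
    \<bar>\<phi> $ i $ j\<bar> powr \<alpha>
      \<le> s $ i $ j * (lo $ i - hi $ j) + (\<pi> $ i - \<pi> $ j) - (lo $ i - hi $ j)"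
  using assms by (simp add: C_pair_def C_rhs1_def C_rhs2_def)

lemma unshifted_pair_not_relaxation:
  fixes i j :: "'v::finite"
  shows "\<exists>(b :: real^'v^'v) lo hi \<phi> \<pi> s.
    within_bounds lo hi \<pi> \<and> s $ i $ j \<in> {-1, 1} \<and> s $ i $ j * \<phi> $ i $ j \<ge> 0 \<and>
    potential_drop (\<lambda>_ _. dissipation \<alpha>) b \<phi> \<pi> i j \<and>
    \<not> \<bar>\<phi> $ i $ j\<bar> powr \<alpha>
      \<le> s $ i $ j * (lo $ i - hi $ j) + (\<pi> $ i - \<pi> $ j) - (lo $ i - hi $ j)"
  by (intro exI[of _ "\<chi> i j. 1"] exI[of _ 0])
    (simp add: within_bounds_def potential_drop_def dissipation_def)

definition relaxed_feasible ::
  "real \<Rightarrow> ('v \<times> 'v) set \<Rightarrow> real^'v^'v \<Rightarrow> real^'v \<Rightarrow> real^'v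
     \<Rightarrow> ((real^'v::finite) \<times> (real^'v^'v) \<times> (real^'v) \<times> (real^'v^'v)) set" where
  "relaxed_feasible \<alpha> E b lo hi =
     {(x, \<phi>, \<pi>, s). flow_balance E \<phi> x
        \<and> (\<forall>(i, j)\<in>E. s $ i $ j \<in> {-1, 1} \<and> C_pair \<alpha> b lo hi \<phi> \<pi> s i j)
        \<and> within_bounds lo hi \<pi>}"

definition mccormick :: "real \<Rightarrow> real \<Rightarrow> real \<Rightarrow> real \<Rightarrow> (real \<times> real \<times> real) set" where
  "mccormick uL uU vL vU =
     {(u, v, w). u \<in> {uL..uU} \<and> v \<in> {vL..vU}
        \<and> w \<ge> uL * v + u * vL - uL * vL
        \<and> w \<ge> uU * v + u * vU - uU * vU
        \<and> w \<le> uU * v + u * vL - uU * vL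
        \<and> w \<le> uL * v + u * vU - uL * vU}"

definition is_convex_envelope :: "('a::real_vector \<Rightarrow> real) \<Rightarrow> ('a \<Rightarrow> real) \<Rightarrow> 'a set \<Rightarrow> bool" where
  "is_convex_envelope g f S \<longleftrightarrow> convex_on S g \<and> (\<forall>z\<in>S. g z \<le> f z)
     \<and> (\<forall>h. convex_on S h \<and> (\<forall>z\<in>S. h z \<le> f z) \<longrightarrow> (\<forall>z\<in>S. h z \<le> g z))"

definition is_concave_envelope :: "('a::real_vector \<Rightarrow> real) \<Rightarrow> ('a \<Rightarrow> real) \<Rightarrow> 'a set \<Rightarrow> bool" where
  "is_concave_envelope g f S \<longleftrightarrow> concave_on S g \<and> (\<forall>z\<in>S. f z \<le> g z)
     \<and> (\<forall>h. concave_on S h \<and> (\<forall>z\<in>S. f z \<le> h z) \<longrightarrow> (\<forall>z\<in>S. g z \<le> h z))"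

text \<open>
  A mixed integer convex constraint set: finitely many inequalities \<open>g z \<le> 0\<close> with \<open>g\<close> jointly
  convex in all variables (the binary ones taken as real), plus the requirement that
  the variables in \<open>B\<close>, given as coordinate functionals, take values in \<open>{-1, 1}\<close>.
  An affine equation is a pair of such inequalities.
\<close>

definition mixed_integer_convex :: "('a::real_vector \<Rightarrow> real) set \<Rightarrow> 'a set \<Rightarrow> bool" where
  "mixed_integer_convex B S \<longleftrightarrow> (\<forall>\<sigma>\<in>B. linear \<sigma>) \<and>
     (\<exists>G. finite G \<and> (\<forall>g\<in>G. convex_on UNIV g) \<and>
       S = {z. (\<forall>g\<in>G. g z \<le> 0) \<and> (\<forall>\<sigma>\<in>B. \<sigma> z \<in> {-1, 1})})"

text \<open>The optimal value of a minimisation problem; it is \<open>\<infinity>\<close> if the problem is infeasible.\<close>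

definition optimal_value :: "('a \<Rightarrow> real) \<Rightarrow> 'a set \<Rightarrow> ereal" where
  "optimal_value obj S = (INF z\<in>S. ereal (obj z))"

end

theory Submission
  imports Defs
begin

text \<open>
  Write \<open>v = \<pi>\<^sub>i - \<pi>\<^sub>j + b\<^sub>i\<^sub>j\<close>.  On the box \<open>[-1, 1] \<times> [L, U]\<close> the bilinear term \<open>s * v\<close> lies
  between its McCormick bounds, since each of the four McCormick inequalities is the expanded form
  of a product of two terms of known sign.  At a vertex \<open>s = -1\<close> or \<open>s = 1\<close> one of these factors
  vanishes in a lower and in an upper inequality, so the bounds close up to \<open>s * v\<close>.  The right-hand
  sides of the pair (C) are exactly the two upper McCormick bounds; hence for binary \<open>s\<close> the pair
  says \<open>\<bar>\<phi>\<bar> powr \<alpha> \<le> s * v\<close>, which the potential drop relation satisfies with equality as soon as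
  \<open>s\<close> is a sign of the flow.  (The
  lemmas are \<open>mult_mccormick_bounds\<close>, \<open>mccormick_tight\<close> and \<open>C_pair_binary_iff\<close>.)  Choosing such
  a sign on every edge embeds the feasible set of the maximum throughput problem into the relaxed
  one without changing the cost (\<open>feasible_lifts_to_relaxed\<close>).

  That the McCormick bounds are the envelopes, and not merely bounds, is a vertex argument: each
  diagonal cuts the box into two triangles, and on each triangle one of the affine bounds
  interpolates the product at the three corners, so Jensen's inequality places every convex
  minorant below the lower bounds (\<open>convex_on_parallelogram\<close>) and, with the other diagonal, every
  concave majorant above the upper ones.  Convexity of the constraints comes down to convexity of
  \<open>\<bar>x\<bar> powr \<alpha>\<close> (\<open>abs_powr_convex\<close>), as everything else is affine.
\<close>

section \<open>Convex functions\<close>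

lemma convex_on_affine:
  assumes "\<And>x y t. g ((1 - t) *\<^sub>R x + t *\<^sub>R y) = (1 - t) * g x + t * g y"
  shows "convex_on UNIV g"
  by (rule convex_onI) (simp_all add: assms)

lemma convex_on_compose_linear:
  assumes "linear l" "convex_on UNIV f"
  shows "convex_on UNIV (\<lambda>z. f (l z))"
  using assms unfolding convex_on_def by (simp add: linear_add linear_scale)

lemma convex_on_max:
  assumes "convex_on S f" "convex_on S g"
  shows "convex_on S (\<lambda>z. max (f z) (g z))"
  unfolding convex_on_def
proof (intro conjI ballI allI impI)
  show "convex S"
    using assms(1) by (rule convex_on_imp_convex)
next
  fix x y :: 'a and u v :: real
  assume *: "x \<in> S" "y \<in> S" "0 \<le> u" "0 \<le> v" "u + v = 1"
  have "f (u *\<^sub>R x + v *\<^sub>R y) \<le> u * f x + v * f y" "g (u *\<^sub>R x + v *\<^sub>R y) \<le> u * g x + v * g y"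
    using assms * unfolding convex_on_def by blast+
  moreover have "u * f x \<le> u * max (f x) (g x)" "u * g x \<le> u * max (f x) (g x)"
    "v * f y \<le> v * max (f y) (g y)" "v * g y \<le> v * max (f y) (g y)"
    using * by (auto intro: mult_left_mono)
  ultimately show "max (f (u *\<^sub>R x + v *\<^sub>R y)) (g (u *\<^sub>R x + v *\<^sub>R y))
      \<le> u * max (f x) (g x) + v * max (f y) (g y)"
    by linarith
qed

text \<open>
  Convexity of \<open>x powr p\<close> on the open half line extends to the origin because a weight \<open>v \<le> 1\<close>
  satisfies \<open>v powr p \<le> v\<close>.
\<close>

lemma powr_convex_nonneg:
  assumes "p \<ge> 1"
  shows "convex_on {0..} (\<lambda>x::real. x powr p)"
proof -
  have scale: "(t * y) powr p \<le> t * y powr p" if "0 \<le> t" "t \<le> 1" "0 \<le> y" for t y :: real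
  proof -
    have "t powr p \<le> t powr 1"
      using that assms by (intro powr_mono') auto
    then have "t powr p \<le> t"
      using that by simp
    then show ?thesis
      using that by (simp add: powr_mult mult_right_mono)
  qed
  show ?thesis
    unfolding convex_on_def
  proof (intro conjI ballI allI impI)
    fix x y u v :: real
    assume *: "x \<in> {0..}" "y \<in> {0..}" "0 \<le> u" "0 \<le> v" "u + v = 1"
    consider "x = 0" | "y = 0" | "x > 0" "y > 0"
      using * by fastforce
    then show "(u *\<^sub>R x + v *\<^sub>R y) powr p \<le> u * x powr p + v * y powr p"
    proof cases
      case 1
      then show ?thesis using * scale[of v y] by simp
    next
      case 2
      then show ?thesis using * scale[of u x] by simp
    next
      case 3
      then show ?thesis
        using powr_convex[OF assms] * unfolding convex_on_def by auto
    qed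
  qed simp
qed

lemma abs_powr_convex:
  assumes "p \<ge> 1"
  shows "convex_on UNIV (\<lambda>x::real. \<bar>x\<bar> powr p)"
  unfolding convex_on_def
proof (intro conjI ballI allI impI)
  fix x y u v :: real
  assume *: "0 \<le> u" "0 \<le> v" "u + v = 1"
  have "\<bar>u *\<^sub>R x + v *\<^sub>R y\<bar> \<le> u * \<bar>x\<bar> + v * \<bar>y\<bar>"
    using abs_triangle_ineq[of "u * x" "v * y"] * by (simp add: abs_mult)
  then have "\<bar>u *\<^sub>R x + v *\<^sub>R y\<bar> powr p \<le> (u * \<bar>x\<bar> + v * \<bar>y\<bar>) powr p"
    using assms by (intro powr_mono2) auto
  also have "\<dots> \<le> u * \<bar>x\<bar> powr p + v * \<bar>y\<bar> powr p"
    using powr_convex_nonneg[OF assms] * unfolding convex_on_def by auto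
  finally show "\<bar>u *\<^sub>R x + v *\<^sub>R y\<bar> powr p \<le> u * \<bar>x\<bar> powr p + v * \<bar>y\<bar> powr p" .
qed simp

section \<open>McCormick bounds as envelopes\<close>

lemma convex_on_three_points:
  assumes "convex_on S f" "x \<in> S" "y \<in> S" "z \<in> S"
    and "0 \<le> a" "0 \<le> b" "0 \<le> c" "a + b + c = 1"
  shows "f (a *\<^sub>R x + b *\<^sub>R y + c *\<^sub>R z) \<le> a * f x + b * f y + c * f z"
  using convex_on_sum[of "{0,1,2::nat}" S f "\<lambda>i. if i = 0 then a else if i = 1 then b else c"
      "\<lambda>i. if i = 0 then x else if i = 1 then y else z"] assms
  by (auto simp: add.assoc convex_on_imp_convex)

text \<open>
  The diagonal joining the two neighbours \<open>B\<close> and \<open>C\<close> of \<open>A\<close> splits the parallelogram into two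
  triangles, and a point lies in the triangle at \<open>A\<close> iff \<open>p + q \<le> 1\<close>.  The coefficients are its
  barycentric coordinates in the two triangles.  The corner values enter only through upper bounds,
  so that for a minorant \<open>h\<close> of the product they can be the corner values of the product itself.
\<close>

lemma convex_on_parallelogram:
  assumes h: "convex_on S h"
    and corners: "A \<in> S" "B \<in> S" "C \<in> S" "D \<in> S" and D: "A + D = B + C"
    and pq: "p \<in> {0..1}" "q \<in> {0..1}"
    and z: "z = A + p *\<^sub>R (B - A) + q *\<^sub>R (C - A)"
    and le: "h A \<le> \<alpha>" "h B \<le> \<beta>" "h C \<le> \<gamma>" "h D \<le> \<delta>"
  shows "h z \<le> max ((1 - p - q) * \<alpha> + p * \<beta> + q * \<gamma>)
    ((p + q - 1) * \<delta> + (1 - q) * \<beta> + (1 - p) * \<gamma>)"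
proof (cases "p + q \<le> 1")
  case True
  have "z = (1 - p - q) *\<^sub>R A + p *\<^sub>R B + q *\<^sub>R C"
    unfolding z by (simp add: algebra_simps)
  then have "h z \<le> (1 - p - q) * h A + p * h B + q * h C"
    using convex_on_three_points[OF h corners(1-3), of "1 - p - q" p q] True pq by auto
  also have "\<dots> \<le> (1 - p - q) * \<alpha> + p * \<beta> + q * \<gamma>"
    using le pq True by (intro add_mono mult_left_mono) auto
  finally show ?thesis by simp
next
  case False
  have D': "D = B + C - A"
    using D by (simp add: algebra_simps)
  have "z = (p + q - 1) *\<^sub>R D + (1 - q) *\<^sub>R B + (1 - p) *\<^sub>R C"
    unfolding z D' by (simp add: algebra_simps)
  then have "h z \<le> (p + q - 1) * h D + (1 - q) * h B + (1 - p) * h C"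
    using convex_on_three_points[OF h corners(4,2,3), of "p + q - 1" "1 - q" "1 - p"] False pq
    by auto
  also have "\<dots> \<le> (p + q - 1) * \<delta> + (1 - q) * \<beta> + (1 - p) * \<gamma>"
    using le pq False by (intro add_mono mult_left_mono) auto
  finally show ?thesis by simp
qed

lemma interval_parameter:
  fixes x a b :: real
  assumes "x \<in> {a..b}"
  obtains t where "t \<in> {0..1}" "x = a + t * (b - a)"
proof (cases "a = b")
  case True
  then show ?thesis using assms that[of 0] by auto
next
  case False
  then show ?thesis
    using assms by (intro that[of "(x - a) / (b - a)"]) (auto simp: divide_simps)
qed

lemma mult_mccormick_bounds:
  fixes u v :: real
  assumes "u \<in> {uL..uU}" "v \<in> {vL..vU}"
  shows "uL * v + u * vL - uL * vL \<le> u * v" "uU * v + u * vU - uU * vU \<le> u * v"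
    "u * v \<le> uU * v + u * vL - uU * vL" "u * v \<le> uL * v + u * vU - uL * vU"
proof -
  have "0 \<le> (u - uL) * (v - vL)" "0 \<le> (uU - u) * (vU - v)"
    "0 \<le> (uU - u) * (v - vL)" "0 \<le> (u - uL) * (vU - v)"
    using assms by auto
  then show "uL * v + u * vL - uL * vL \<le> u * v" "uU * v + u * vU - uU * vU \<le> u * v"
    "u * v \<le> uU * v + u * vL - uU * vL" "u * v \<le> uL * v + u * vU - uL * vU"
    by (simp_all add: algebra_simps)
qed

text \<open>
  The coefficients are free because the planes occur with both signs: the smaller of the two upper
  bounds is the negative of the larger of their negatives.
\<close>

lemma convex_on_max_planes:
  fixes S :: "(real \<times> real) set"
  assumes "convex S"
  shows "convex_on S (\<lambda>(u, v). max (a * v + u * b - k) (a' * v + u * b' - k'))"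
proof -
  have plane: "convex_on UNIV (\<lambda>z :: real \<times> real. a * snd z + fst z * b - k)" for a b k
    by (rule convex_on_affine) (simp add: algebra_simps)
  show ?thesis
    using convex_on_subset[OF convex_on_max[OF plane plane] _ assms]
    by (simp add: case_prod_unfold)
qed

lemma mccormick_convex_envelope:
  assumes "uL \<le> uU" "vL \<le> vU"
  shows "is_convex_envelope
    (\<lambda>(u, v). max (uL * v + u * vL - uL * vL) (uU * v + u * vU - uU * vU))
    (\<lambda>(u, v). u * v) ({uL..uU} \<times> {vL..vU})" (is "is_convex_envelope ?g ?f ?S")
  unfolding is_convex_envelope_def
proof (intro conjI allI impI ballI)
  show "convex_on ?S ?g"
    by (intro convex_on_max_planes convex_Times convex_real_interval)
next
  fix z assume "z \<in> ?S"
  moreover obtain u v where "z = (u, v)" by (cases z)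
  ultimately show "?g z \<le> ?f z"
    using mult_mccormick_bounds[of u uL uU v vL vU] by auto
next
  fix h and z :: "real \<times> real"
  assume "convex_on ?S h \<and> (\<forall>z\<in>?S. h z \<le> ?f z)" and zS: "z \<in> ?S"
  then have h: "convex_on ?S h" and le: "\<And>u v. (u, v) \<in> ?S \<Longrightarrow> h (u, v) \<le> u * v"
    by auto
  obtain u v where z: "z = (u, v)" by (cases z)
  obtain p where p: "p \<in> {0..1}" "u = uL + p * (uU - uL)"
    using zS z interval_parameter[of u uL uU] by blast
  obtain q where q: "q \<in> {0..1}" "v = vL + q * (vU - vL)"
    using zS z interval_parameter[of v vL vU] by blast
  have corners: "(uL, vL) \<in> ?S" "(uU, vL) \<in> ?S" "(uL, vU) \<in> ?S" "(uU, vU) \<in> ?S"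
    using assms by auto
  have "h z \<le> max ((1 - p - q) * (uL * vL) + p * (uU * vL) + q * (uL * vU))
      ((p + q - 1) * (uU * vU) + (1 - q) * (uU * vL) + (1 - p) * (uL * vU))"
    using p q z
    by (intro convex_on_parallelogram[OF h corners _ p(1) q(1)] le corners) auto
  also have "\<dots> = ?g z"
    unfolding z p(2) q(2) by (simp add: algebra_simps)
  finally show "h z \<le> ?g z" .
qed

text \<open>The same vertex argument for \<open>- h\<close>, with the box cut along its other diagonal.\<close>

lemma mccormick_concave_envelope:
  assumes "uL \<le> uU" "vL \<le> vU"
  shows "is_concave_envelope
    (\<lambda>(u, v). min (uU * v + u * vL - uU * vL) (uL * v + u * vU - uL * vU))
    (\<lambda>(u, v). u * v) ({uL..uU} \<times> {vL..vU})" (is "is_concave_envelope ?g ?f ?S")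
  unfolding is_concave_envelope_def
proof (intro conjI allI impI ballI)
  have "convex_on ?S (\<lambda>(u, v). max ((- uU) * v + u * (- vL) - (- (uU * vL)))
      ((- uL) * v + u * (- vU) - (- (uL * vU))))"
    by (intro convex_on_max_planes convex_Times convex_real_interval)
  also have "(\<lambda>(u, v). max ((- uU) * v + u * (- vL) - (- (uU * vL)))
      ((- uL) * v + u * (- vU) - (- (uL * vU)))) = (\<lambda>z. - ?g z)"
    by (auto simp: fun_eq_iff max_def min_def)
  finally show "concave_on ?S ?g"
    by (simp add: concave_on_def)
next
  fix z assume "z \<in> ?S"
  moreover obtain u v where "z = (u, v)" by (cases z)
  ultimately show "?f z \<le> ?g z"
    using mult_mccormick_bounds[of u uL uU v vL vU] by auto
next
  fix h and z :: "real \<times> real"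
  assume *: "concave_on ?S h \<and> (\<forall>z\<in>?S. ?f z \<le> h z)" and zS: "z \<in> ?S"
  then have h: "convex_on ?S (\<lambda>z. - h z)" and le: "\<And>u v. (u, v) \<in> ?S \<Longrightarrow> - h (u, v) \<le> - (u * v)"
    by (auto simp: concave_on_def)
  obtain u v where z: "z = (u, v)" by (cases z)
  obtain p where p: "p \<in> {0..1}" "u = uL + p * (uU - uL)"
    using zS z interval_parameter[of u uL uU] by blast
  obtain q' where q': "q' \<in> {0..1}" "v = vL + q' * (vU - vL)"
    using zS z interval_parameter[of v vL vU] by blast
  define q where "q = 1 - q'"
  have q: "q \<in> {0..1}" "v = vU + q * (vL - vU)"
    using q' by (auto simp: q_def algebra_simps)
  have corners: "(uL, vU) \<in> ?S" "(uU, vU) \<in> ?S" "(uL, vL) \<in> ?S" "(uU, vL) \<in> ?S"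
    using assms by auto
  have "- h z \<le> max ((1 - p - q) * (- (uL * vU)) + p * (- (uU * vU)) + q * (- (uL * vL)))
      ((p + q - 1) * (- (uU * vL)) + (1 - q) * (- (uU * vU)) + (1 - p) * (- (uL * vL)))"
    using p q z
    by (intro convex_on_parallelogram[OF h corners _ p(1) q(1)] le corners) auto
  also have "\<dots> = max (- (uL * v + u * vU - uL * vU)) (- (uU * v + u * vL - uU * vL))"
    unfolding p(2) q(2) by (simp add: algebra_simps)
  also have "\<dots> = - ?g z"
    unfolding z by (auto simp: max_def min_def)
  finally show "?g z \<le> h z" by simp
qed

text \<open>
  The interval between the McCormick bounds contains the product and is thus nonempty, so a number below both upper
  bounds is dominated by an admissible value of the relaxed product, namely the smaller upper bound.
\<close>

lemma mccormick_upper_iff: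
  assumes "u \<in> {uL..uU}" "v \<in> {vL..vU}"
  shows "(\<exists>w. (u, v, w) \<in> mccormick uL uU vL vU \<and> y \<le> w) \<longleftrightarrow>
    y \<le> uU * v + u * vL - uU * vL \<and> y \<le> uL * v + u * vU - uL * vU"
proof
  assume "y \<le> uU * v + u * vL - uU * vL \<and> y \<le> uL * v + u * vU - uL * vU"
  then show "\<exists>w. (u, v, w) \<in> mccormick uL uU vL vU \<and> y \<le> w"
    using mult_mccormick_bounds[OF assms] assms
    by (intro exI[of _ "min (uU * v + u * vL - uU * vL) (uL * v + u * vU - uL * vU)"])
      (auto simp: mccormick_def)
qed (auto simp: mccormick_def)

lemma mccormick_tight:
  assumes "u \<in> {uL, uU}" "uL \<le> uU" "v \<in> {vL..vU}"
  shows "(u, v, w) \<in> mccormick uL uU vL vU \<longleftrightarrow> w = u * v"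
  using assms mult_mccormick_bounds[of u uL uU v vL vU] by (auto simp: mccormick_def)

section \<open>The pair of inequalities on an edge\<close>

text \<open>
  At zero flow either sign is admissible, but there the dissipation vanishes and the choice does
  not matter.
\<close>

lemma potential_drop_iff_signed:
  assumes "s \<in> {-1, 1}" "s * \<phi> $ i $ j \<ge> 0"
  shows "potential_drop (\<lambda>_ _. dissipation \<alpha>) b \<phi> \<pi> i j
    \<longleftrightarrow> \<pi> $ i - \<pi> $ j + b $ i $ j = s * \<bar>\<phi> $ i $ j\<bar> powr \<alpha>"
proof -
  have "dissipation \<alpha> (\<phi> $ i $ j) = s * \<bar>\<phi> $ i $ j\<bar> powr \<alpha>"
    using assms by (cases "\<phi> $ i $ j" "0 :: real" rule: linorder_cases)
      (auto simp: dissipation_def)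
  then show ?thesis
    by (auto simp: potential_drop_def)
qed

lemma sign_mult_eq_iff:
  fixes s y t :: real
  assumes "s \<in> {-1, 1}"
  shows "y = s * t \<longleftrightarrow> s * y = t"
  using assms by auto

lemma within_bounds_drop:
  assumes "within_bounds lo hi \<pi>"
  shows "\<pi> $ i - \<pi> $ j + b $ i $ j
    \<in> {lo $ i - hi $ j + b $ i $ j..hi $ i - lo $ j + b $ i $ j}"
proof -
  have "lo $ i \<le> \<pi> $ i" "\<pi> $ i \<le> hi $ i" "lo $ j \<le> \<pi> $ j" "\<pi> $ j \<le> hi $ j"
    using assms by (auto simp: within_bounds_def)
  then show ?thesis by simp
qed

lemma C_pair_iff_mccormick:
  assumes "s $ i $ j \<in> {-1..1}" "within_bounds lo hi \<pi>"
  shows "C_pair \<alpha> b lo hi \<phi> \<pi> s i j \<longleftrightarrow>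
    (\<exists>w. (s $ i $ j, \<pi> $ i - \<pi> $ j + b $ i $ j, w)
           \<in> mccormick (-1) 1 (lo $ i - hi $ j + b $ i $ j) (hi $ i - lo $ j + b $ i $ j)
         \<and> \<bar>\<phi> $ i $ j\<bar> powr \<alpha> \<le> w)"
  unfolding mccormick_upper_iff[OF assms(1) within_bounds_drop[OF assms(2)]]
  by (auto simp: C_pair_def C_rhs1_def C_rhs2_def)

lemma C_pair_binary_iff:
  assumes "s $ i $ j \<in> {-1, 1}" "within_bounds lo hi \<pi>"
  shows "C_pair \<alpha> b lo hi \<phi> \<pi> s i j
    \<longleftrightarrow> \<bar>\<phi> $ i $ j\<bar> powr \<alpha> \<le> s $ i $ j * (\<pi> $ i - \<pi> $ j + b $ i $ j)"
proof -
  have "s $ i $ j \<in> {-1..1}"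
    using assms(1) by auto
  then show ?thesis
    using assms mccormick_tight[OF assms(1) _ within_bounds_drop[OF assms(2)]]
    by (simp add: C_pair_iff_mccormick)
qed

lemma potential_drop_imp_C_pair:
  assumes "s $ i $ j \<in> {-1, 1}" "s $ i $ j * \<phi> $ i $ j \<ge> 0" "within_bounds lo hi \<pi>"
    and "potential_drop (\<lambda>_ _. dissipation \<alpha>) b \<phi> \<pi> i j"
  shows "C_pair \<alpha> b lo hi \<phi> \<pi> s i j"
  using assms potential_drop_iff_signed[OF assms(1,2)]
    sign_mult_eq_iff[OF assms(1)] C_pair_binary_iff[OF assms(1,3)] by simp

section \<open>Mixed integer convexity\<close>

text \<open>
  The bounds and \<open>b\<close> are constants, so both right-hand sides are affine in the potentials and the
  direction jointly; this is what the relaxation gains over the bilinear term.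
\<close>

lemma C_rhs_convex:
  fixes b :: "real^'v^'v" and lo hi :: "real^'v::finite"
  assumes "\<alpha> \<ge> 1"
  shows "convex_on UNIV
      (\<lambda>(\<phi> :: real^'v^'v, \<pi>, s). \<bar>\<phi> $ i $ j\<bar> powr \<alpha> - C_rhs1 b lo hi \<pi> s i j)" (is ?A)
    and "convex_on UNIV
      (\<lambda>(\<phi> :: real^'v^'v, \<pi>, s). \<bar>\<phi> $ i $ j\<bar> powr \<alpha> - C_rhs2 b lo hi \<pi> s i j)" (is ?B)
proof -
  have "linear (\<lambda>z :: (real^'v^'v) \<times> (real^'v) \<times> (real^'v^'v). fst z $ i $ j)"
    by (rule linearI) auto
  from convex_on_compose_linear[OF this abs_powr_convex[OF assms]]
  have powr: "convex_on UNIV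
      (\<lambda>z :: (real^'v^'v) \<times> (real^'v) \<times> (real^'v^'v). \<bar>fst z $ i $ j\<bar> powr \<alpha>)" .
  have "convex_on UNIV (\<lambda>z :: (real^'v^'v) \<times> (real^'v) \<times> (real^'v^'v).
      - C_rhs1 b lo hi (fst (snd z)) (snd (snd z)) i j)"
    by (rule convex_on_affine) (simp add: C_rhs1_def algebra_simps)
  from convex_on_add[OF powr this] show ?A
    by (simp add: case_prod_unfold)
  have "convex_on UNIV (\<lambda>z :: (real^'v^'v) \<times> (real^'v) \<times> (real^'v^'v).
      - C_rhs2 b lo hi (fst (snd z)) (snd (snd z)) i j)"
    by (rule convex_on_affine) (simp add: C_rhs2_def algebra_simps)
  from convex_on_add[OF powr this] show ?B
    by (simp add: case_prod_unfold)
qed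

lemma C_pair_mixed_integer_convex:
  fixes b :: "real^'v^'v" and lo hi :: "real^'v::finite"
  assumes "\<alpha> \<ge> 1"
  shows "mixed_integer_convex {\<lambda>(\<phi>, \<pi>, s). s $ i $ j}
    {(\<phi> :: real^'v^'v, \<pi>, s). s $ i $ j \<in> {-1, 1} \<and> C_pair \<alpha> b lo hi \<phi> \<pi> s i j}"
  unfolding mixed_integer_convex_def
proof (intro conjI exI)
  let ?G = "{\<lambda>(\<phi> :: real^'v^'v, \<pi>, s). \<bar>\<phi> $ i $ j\<bar> powr \<alpha> - C_rhs1 b lo hi \<pi> s i j,
    \<lambda>(\<phi> :: real^'v^'v, \<pi>, s). \<bar>\<phi> $ i $ j\<bar> powr \<alpha> - C_rhs2 b lo hi \<pi> s i j}"
  show "finite ?G" by simp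
  show "\<forall>g\<in>?G. convex_on UNIV g"
    using C_rhs_convex[OF assms, of i j b lo hi] by blast
  show "{(\<phi> :: real^'v^'v, \<pi>, s). s $ i $ j \<in> {-1, 1} \<and> C_pair \<alpha> b lo hi \<phi> \<pi> s i j}
      = {z. (\<forall>g\<in>?G. g z \<le> 0) \<and>
            (\<forall>\<sigma>\<in>{\<lambda>(\<phi> :: real^'v^'v, \<pi> :: real^'v, s :: real^'v^'v). s $ i $ j}. \<sigma> z \<in> {-1, 1})}"
    by (auto simp: C_pair_def)
qed (auto intro!: linearI)

lemma linear_flow: "linear (\<lambda>\<phi>. flow E \<phi> i j)"
  by (rule linearI) (auto simp: flow_def)

lemma linear_imp_convex_on: "linear g \<Longrightarrow> convex_on UNIV g"
  by (rule convex_on_affine) (simp add: linear_add linear_scale)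

text \<open>
  A balance equation is encoded by its affine excess and the negative of it.  The edge constraints
  do not involve the injections, so they are pulled back along the projection that drops \<open>x\<close>.
\<close>

lemma relaxed_feasible_mixed_integer_convex:
  fixes E :: "('v::finite \<times> 'v) set" and b :: "real^'v^'v" and lo hi :: "real^'v"
  assumes "\<alpha> \<ge> 1"
  shows "mixed_integer_convex ((\<lambda>(i, j). \<lambda>(x, \<phi>, \<pi>, s). s $ i $ j) ` E)
    (relaxed_feasible \<alpha> E b lo hi)"
proof -
  define excess :: "'v \<Rightarrow> (real^'v) \<times> (real^'v^'v) \<times> (real^'v) \<times> (real^'v^'v) \<Rightarrow> real"
    where "excess i z = (\<Sum>j\<in>neighbours E i. flow E (fst (snd z)) i j) - fst z $ i" for i z
  define below :: "'v \<Rightarrow> (real^'v) \<times> (real^'v^'v) \<times> (real^'v) \<times> (real^'v^'v) \<Rightarrow> real"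
    where "below i z = lo $ i - fst (snd (snd z)) $ i" for i z
  define above :: "'v \<Rightarrow> (real^'v) \<times> (real^'v^'v) \<times> (real^'v) \<times> (real^'v^'v) \<Rightarrow> real"
    where "above i z = fst (snd (snd z)) $ i - hi $ i" for i z
  define c1 :: "'v \<times> 'v \<Rightarrow> (real^'v) \<times> (real^'v^'v) \<times> (real^'v) \<times> (real^'v^'v) \<Rightarrow> real"
    where "c1 = (\<lambda>(i, j) z. (\<lambda>(\<phi> :: real^'v^'v, \<pi>, s).
      \<bar>\<phi> $ i $ j\<bar> powr \<alpha> - C_rhs1 b lo hi \<pi> s i j) (snd z))"
  define c2 :: "'v \<times> 'v \<Rightarrow> (real^'v) \<times> (real^'v^'v) \<times> (real^'v) \<times> (real^'v^'v) \<Rightarrow> real"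
    where "c2 = (\<lambda>(i, j) z. (\<lambda>(\<phi> :: real^'v^'v, \<pi>, s).
      \<bar>\<phi> $ i $ j\<bar> powr \<alpha> - C_rhs2 b lo hi \<pi> s i j) (snd z))"
  let ?G = "range excess \<union> range (\<lambda>i z. - excess i z) \<union> range below \<union> range above
    \<union> c1 ` E \<union> c2 ` E"
  have excess: "linear (excess i)" for i
    unfolding excess_def
    by (rule linearI)
      (simp_all add: linear_add[OF linear_flow] linear_scale[OF linear_flow] sum.distrib
        sum_distrib_left algebra_simps)
  have "convex_on UNIV (excess i)" "convex_on UNIV (\<lambda>z. - excess i z)" for i
    using excess[of i] by (auto intro!: linear_imp_convex_on linear_compose_neg)
  moreover have "convex_on UNIV (below i)" "convex_on UNIV (above i)" for i
    by (rule convex_on_affine, simp add: below_def above_def algebra_simps)+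
  moreover have "convex_on UNIV (c1 e)" "convex_on UNIV (c2 e)" for e
    using convex_on_compose_linear[OF linear_snd C_rhs_convex(1)[OF assms], of "fst e" "snd e" b lo hi]
      convex_on_compose_linear[OF linear_snd C_rhs_convex(2)[OF assms], of "fst e" "snd e" b lo hi]
    unfolding c1_def c2_def case_prod_unfold by auto
  ultimately have conv: "\<forall>g\<in>?G. convex_on UNIV g" by blast
  have "z \<in> relaxed_feasible \<alpha> E b lo hi \<longleftrightarrow>
    (\<forall>g\<in>?G. g z \<le> 0) \<and>
    (\<forall>\<sigma>\<in>(\<lambda>(i, j). \<lambda>(x, \<phi>, \<pi>, s). s $ i $ j) ` E. \<sigma> z \<in> {-1, 1})" for z
  proof -
    obtain x \<phi> \<pi> s where z: "z = (x, \<phi>, \<pi>, s)"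
      by (cases z)
    have "flow_balance E \<phi> x \<longleftrightarrow>
      (\<forall>i. excess i z \<le> 0) \<and> (\<forall>i. - excess i z \<le> 0)"
      by (simp add: flow_balance_def excess_def z flip: all_conj_distrib) (simp add: eq_iff)
    moreover have "within_bounds lo hi \<pi> \<longleftrightarrow>
      (\<forall>i. below i z \<le> 0) \<and> (\<forall>i. above i z \<le> 0)"
      by (auto simp: within_bounds_def below_def above_def z)
    moreover have "(\<forall>(i, j)\<in>E. s $ i $ j \<in> {-1, 1} \<and> C_pair \<alpha> b lo hi \<phi> \<pi> s i j) \<longleftrightarrow>
      (\<forall>e\<in>E. c1 e z \<le> 0) \<and> (\<forall>e\<in>E. c2 e z \<le> 0) \<and>
      (\<forall>(i, j)\<in>E. s $ i $ j \<in> {-1, 1})"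
      by (auto simp: C_pair_def c1_def c2_def z case_prod_unfold)
    ultimately show ?thesis
      unfolding z by (auto simp: relaxed_feasible_def ball_Un case_prod_unfold)
  qed
  then have "relaxed_feasible \<alpha> E b lo hi = {z. (\<forall>g\<in>?G. g z \<le> 0) \<and>
    (\<forall>\<sigma>\<in>(\<lambda>(i, j). \<lambda>(x, \<phi>, \<pi>, s). s $ i $ j) ` E. \<sigma> z \<in> {-1, 1})}"
    by (intro set_eqI) (simp only: mem_Collect_eq)
  moreover have "finite ?G" by simp
  moreover have "\<forall>\<sigma>\<in>(\<lambda>(i, j). \<lambda>(x :: real^'v, \<phi> :: real^'v^'v, \<pi> :: real^'v, s :: real^'v^'v).
      s $ i $ j) ` E. linear \<sigma>"
    by (auto intro!: linearI)
  ultimately show ?thesis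
    unfolding mixed_integer_convex_def using conv
    by (intro conjI exI[of _ ?G]) assumption+
qed

section \<open>Relaxing the maximum throughput problem\<close>

lemma feasible_lifts_to_relaxed:
  fixes \<phi> :: "real^'v^'v::finite"
  assumes "(x, \<phi>, \<pi>) \<in> max_throughput_feasible (\<lambda>_ _. dissipation \<alpha>) E b lo hi"
  shows "\<exists>s. (\<forall>(i, j)\<in>E. s $ i $ j * \<phi> $ i $ j \<ge> 0) \<and>
    (x, \<phi>, \<pi>, s) \<in> relaxed_feasible \<alpha> E b lo hi"
proof (intro exI conjI)
  \<comment> \<open>\<open>sgn\<close> itself would take the value 0 on edges without flow.\<close>
  let ?s = "(\<chi> i j. if \<phi> $ i $ j \<ge> 0 then 1 else - 1) :: real^'v^'v"
  show "\<forall>(i, j)\<in>E. ?s $ i $ j * \<phi> $ i $ j \<ge> 0" by auto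
  have "C_pair \<alpha> b lo hi \<phi> \<pi> ?s i j" if "(i, j) \<in> E" for i j
    using assms that by (intro potential_drop_imp_C_pair) (auto simp: max_throughput_feasible_def)
  then show "(x, \<phi>, \<pi>, ?s) \<in> relaxed_feasible \<alpha> E b lo hi"
    using assms by (auto simp: max_throughput_feasible_def relaxed_feasible_def)
qed

lemma cost_convex:
  "convex_on UNIV
    (\<lambda>(x :: real^'v::finite, \<phi> :: real^'v^'v, \<pi> :: real^'v, s :: real^'v^'v). cost c x)"
  by (rule linear_imp_convex_on, rule linearI)
    (auto simp: cost_def sum.distrib sum_distrib_left algebra_simps)

lemma relaxed_optimal_value_le:
  "optimal_value (\<lambda>(x, \<phi>, \<pi>, s). cost c x) (relaxed_feasible \<alpha> E b lo hi)
    \<le> optimal_value (\<lambda>(x, \<phi>, \<pi>). cost c x)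
        (max_throughput_feasible (\<lambda>_ _. dissipation \<alpha>) E b lo hi)"
  unfolding optimal_value_def
proof (rule INF_mono)
  fix z assume z: "z \<in> max_throughput_feasible (\<lambda>_ _. dissipation \<alpha>) E b lo hi"
  obtain x \<phi> \<pi> where [simp]: "z = (x, \<phi>, \<pi>)" by (cases z)
  obtain s where "(x, \<phi>, \<pi>, s) \<in> relaxed_feasible \<alpha> E b lo hi"
    using feasible_lifts_to_relaxed z by fastforce
  then show "\<exists>y\<in>relaxed_feasible \<alpha> E b lo hi. ereal (case y of (x, \<phi>, \<pi>, s) \<Rightarrow> cost c x)
      \<le> ereal (case z of (x, \<phi>, \<pi>) \<Rightarrow> cost c x)"
    by (intro bexI[of _ "(x, \<phi>, \<pi>, s)"]) auto
qed


theorem mainTheorem5: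
  fixes \<alpha> :: real and E :: "('v::finite \<times> 'v) set"
    and b :: "real^'v^'v" and c lo hi :: "real^'v"
  assumes "\<alpha> \<ge> 1" and "flow_network E" and "\<And>i. lo $ i \<le> hi $ i"
  shows "(\<forall>(i, j)\<in>E. \<forall>\<phi> \<pi> (s :: real^'v^'v). s $ i $ j \<in> {-1, 1} \<longrightarrow> s $ i $ j * \<phi> $ i $ j \<ge> 0 \<longrightarrow>
         (potential_drop (\<lambda>_ _. dissipation \<alpha>) b \<phi> \<pi> i j
            \<longleftrightarrow> \<pi> $ i - \<pi> $ j + b $ i $ j = s $ i $ j * \<bar>\<phi> $ i $ j\<bar> powr \<alpha>) \<and>
         (potential_drop (\<lambda>_ _. dissipation \<alpha>) b \<phi> \<pi> i j
            \<longleftrightarrow> s $ i $ j * (\<pi> $ i - \<pi> $ j + b $ i $ j) = \<bar>\<phi> $ i $ j\<bar> powr \<alpha>))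
    \<and> (\<forall>(i, j)\<in>E.
         convex_on UNIV (\<lambda>(\<phi> :: real^'v^'v, \<pi>, s). \<bar>\<phi> $ i $ j\<bar> powr \<alpha> - C_rhs1 b lo hi \<pi> s i j) \<and>
         convex_on UNIV (\<lambda>(\<phi> :: real^'v^'v, \<pi>, s). \<bar>\<phi> $ i $ j\<bar> powr \<alpha> - C_rhs2 b lo hi \<pi> s i j) \<and>
         mixed_integer_convex {\<lambda>(\<phi>, \<pi>, s). s $ i $ j}
           {(\<phi>, \<pi>, s). s $ i $ j \<in> {-1, 1} \<and> C_pair \<alpha> b lo hi \<phi> \<pi> s i j})
    \<and> (\<forall>(i, j)\<in>E. let L = lo $ i - hi $ j + b $ i $ j; U = hi $ i - lo $ j + b $ i $ j;
           box = {-1..1} \<times> {L..U} in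
         \<exists>under over. is_convex_envelope under (\<lambda>(u, v). u * v) box \<and>
           is_concave_envelope over (\<lambda>(u, v). u * v) box \<and>
           mccormick (-1) 1 L U = {(u, v, w). (u, v) \<in> box \<and> under (u, v) \<le> w \<and> w \<le> over (u, v)})
    \<and> (\<forall>(i, j)\<in>E. \<forall>\<phi> \<pi> s. s $ i $ j \<in> {-1..1} \<longrightarrow> within_bounds lo hi \<pi> \<longrightarrow>
         (C_pair \<alpha> b lo hi \<phi> \<pi> s i j \<longleftrightarrow>
            (\<exists>w. (s $ i $ j, \<pi> $ i - \<pi> $ j + b $ i $ j, w)
                   \<in> mccormick (-1) 1 (lo $ i - hi $ j + b $ i $ j) (hi $ i - lo $ j + b $ i $ j)
                 \<and> \<bar>\<phi> $ i $ j\<bar> powr \<alpha> \<le> w)))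
    \<and> (\<forall>(i, j)\<in>E. \<forall>\<phi> \<pi> s. s $ i $ j \<in> {-1, 1} \<longrightarrow> s $ i $ j * \<phi> $ i $ j \<ge> 0 \<longrightarrow>
         within_bounds lo hi \<pi> \<longrightarrow>
         potential_drop (\<lambda>_ _. dissipation \<alpha>) b \<phi> \<pi> i j \<longrightarrow> C_pair \<alpha> b lo hi \<phi> \<pi> s i j)
    \<and> (\<forall>(i, j)\<in>E. \<forall>\<pi> (s :: real^'v^'v) w. s $ i $ j \<in> {-1, 1} \<longrightarrow> within_bounds lo hi \<pi> \<longrightarrow>
         ((s $ i $ j, \<pi> $ i - \<pi> $ j + b $ i $ j, w)
            \<in> mccormick (-1) 1 (lo $ i - hi $ j + b $ i $ j) (hi $ i - lo $ j + b $ i $ j)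
          \<longleftrightarrow> w = s $ i $ j * (\<pi> $ i - \<pi> $ j + b $ i $ j)))
    \<and> (\<forall>(i, j)\<in>E. \<forall>\<phi> \<pi> s. s $ i $ j \<in> {-1, 1} \<longrightarrow> within_bounds lo hi \<pi> \<longrightarrow>
         (C_pair \<alpha> b lo hi \<phi> \<pi> s i j
            \<longleftrightarrow> \<bar>\<phi> $ i $ j\<bar> powr \<alpha> \<le> s $ i $ j * (\<pi> $ i - \<pi> $ j + b $ i $ j)))
    \<and> (convex_on UNIV (\<lambda>(x :: real^'v, \<phi> :: real^'v^'v, \<pi> :: real^'v, s :: real^'v^'v). cost c x) \<and>
       mixed_integer_convex ((\<lambda>(i, j). \<lambda>(x, \<phi>, \<pi>, s). s $ i $ j) ` E)
         (relaxed_feasible \<alpha> E b lo hi))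
    \<and> (\<forall>(x, \<phi>, \<pi>) \<in> max_throughput_feasible (\<lambda>_ _. dissipation \<alpha>) E b lo hi.
         \<exists>s. (\<forall>(i, j)\<in>E. s $ i $ j * \<phi> $ i $ j \<ge> 0) \<and>
             (x, \<phi>, \<pi>, s) \<in> relaxed_feasible \<alpha> E b lo hi)
    \<and> (optimal_value (\<lambda>(x, \<phi>, \<pi>, s). cost c x) (relaxed_feasible \<alpha> E b lo hi)
         \<le> optimal_value (\<lambda>(x, \<phi>, \<pi>). cost c x)
              (max_throughput_feasible (\<lambda>_ _. dissipation \<alpha>) E b lo hi))"
proof (intro conjI)
  show "\<forall>(i, j)\<in>E. \<forall>\<phi> \<pi> (s :: real^'v^'v). s $ i $ j \<in> {-1, 1} \<longrightarrow> s $ i $ j * \<phi> $ i $ j \<ge> 0 \<longrightarrow>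
         (potential_drop (\<lambda>_ _. dissipation \<alpha>) b \<phi> \<pi> i j
            \<longleftrightarrow> \<pi> $ i - \<pi> $ j + b $ i $ j = s $ i $ j * \<bar>\<phi> $ i $ j\<bar> powr \<alpha>) \<and>
         (potential_drop (\<lambda>_ _. dissipation \<alpha>) b \<phi> \<pi> i j
            \<longleftrightarrow> s $ i $ j * (\<pi> $ i - \<pi> $ j + b $ i $ j) = \<bar>\<phi> $ i $ j\<bar> powr \<alpha>)"
    by (clarify, simp only: potential_drop_iff_signed sign_mult_eq_iff)
next
  show "\<forall>(i, j)\<in>E.
         convex_on UNIV (\<lambda>(\<phi> :: real^'v^'v, \<pi>, s). \<bar>\<phi> $ i $ j\<bar> powr \<alpha> - C_rhs1 b lo hi \<pi> s i j) \<and>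
         convex_on UNIV (\<lambda>(\<phi> :: real^'v^'v, \<pi>, s). \<bar>\<phi> $ i $ j\<bar> powr \<alpha> - C_rhs2 b lo hi \<pi> s i j) \<and>
         mixed_integer_convex {\<lambda>(\<phi>, \<pi>, s). s $ i $ j}
           {(\<phi>, \<pi>, s). s $ i $ j \<in> {-1, 1} \<and> C_pair \<alpha> b lo hi \<phi> \<pi> s i j}"
    by (clarify, intro conjI C_rhs_convex C_pair_mixed_integer_convex assms(1))
next
  have "\<exists>under over. is_convex_envelope under (\<lambda>(u, v). u * v) ({-1..1} \<times> {L..U}) \<and>
      is_concave_envelope over (\<lambda>(u, v). u * v) ({-1..1} \<times> {L..U}) \<and>
      mccormick (-1) 1 L U
        = {(u, v, w). (u, v) \<in> {-1..1} \<times> {L..U} \<and> under (u, v) \<le> w \<and> w \<le> over (u, v)}"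
    if "L \<le> U" for L U :: real
  proof (intro exI conjI)
    show "is_convex_envelope
        (\<lambda>(u, v). max ((-1) * v + u * L - (-1) * L) (1 * v + u * U - 1 * U))
        (\<lambda>(u, v). u * v) ({-1..1} \<times> {L..U})"
      using that by (intro mccormick_convex_envelope) auto
    show "is_concave_envelope
        (\<lambda>(u, v). min (1 * v + u * L - 1 * L) ((-1) * v + u * U - (-1) * U))
        (\<lambda>(u, v). u * v) ({-1..1} \<times> {L..U})"
      using that by (intro mccormick_concave_envelope) auto
  qed (auto simp: mccormick_def)
  moreover have "lo $ i - hi $ j + b $ i $ j \<le> hi $ i - lo $ j + b $ i $ j" for i j
    using assms(3)[of i] assms(3)[of j] by simp
  ultimately show "\<forall>(i, j)\<in>E. let L = lo $ i - hi $ j + b $ i $ j; U = hi $ i - lo $ j + b $ i $ j;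
           box = {-1..1} \<times> {L..U} in
         \<exists>under over. is_convex_envelope under (\<lambda>(u, v). u * v) box \<and>
           is_concave_envelope over (\<lambda>(u, v). u * v) box \<and>
           mccormick (-1) 1 L U = {(u, v, w). (u, v) \<in> box \<and> under (u, v) \<le> w \<and> w \<le> over (u, v)}"
    unfolding Let_def by blast
next
  show "\<forall>(i, j)\<in>E. \<forall>\<phi> \<pi> s. s $ i $ j \<in> {-1..1} \<longrightarrow> within_bounds lo hi \<pi> \<longrightarrow>
         (C_pair \<alpha> b lo hi \<phi> \<pi> s i j \<longleftrightarrow>
            (\<exists>w. (s $ i $ j, \<pi> $ i - \<pi> $ j + b $ i $ j, w)
                   \<in> mccormick (-1) 1 (lo $ i - hi $ j + b $ i $ j) (hi $ i - lo $ j + b $ i $ j)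
                 \<and> \<bar>\<phi> $ i $ j\<bar> powr \<alpha> \<le> w))"
    by (clarify, rule C_pair_iff_mccormick)
next
  show "\<forall>(i, j)\<in>E. \<forall>\<phi> \<pi> s. s $ i $ j \<in> {-1, 1} \<longrightarrow> s $ i $ j * \<phi> $ i $ j \<ge> 0 \<longrightarrow>
         within_bounds lo hi \<pi> \<longrightarrow>
         potential_drop (\<lambda>_ _. dissipation \<alpha>) b \<phi> \<pi> i j \<longrightarrow> C_pair \<alpha> b lo hi \<phi> \<pi> s i j"
    by (clarify, rule potential_drop_imp_C_pair)
next
  show "\<forall>(i, j)\<in>E. \<forall>\<pi> (s :: real^'v^'v) w. s $ i $ j \<in> {-1, 1} \<longrightarrow> within_bounds lo hi \<pi> \<longrightarrow>
         ((s $ i $ j, \<pi> $ i - \<pi> $ j + b $ i $ j, w)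
            \<in> mccormick (-1) 1 (lo $ i - hi $ j + b $ i $ j) (hi $ i - lo $ j + b $ i $ j)
          \<longleftrightarrow> w = s $ i $ j * (\<pi> $ i - \<pi> $ j + b $ i $ j))"
    by (clarify, rule mccormick_tight[OF _ _ within_bounds_drop]) auto
next
  show "\<forall>(i, j)\<in>E. \<forall>\<phi> \<pi> s. s $ i $ j \<in> {-1, 1} \<longrightarrow> within_bounds lo hi \<pi> \<longrightarrow>
         (C_pair \<alpha> b lo hi \<phi> \<pi> s i j
            \<longleftrightarrow> \<bar>\<phi> $ i $ j\<bar> powr \<alpha> \<le> s $ i $ j * (\<pi> $ i - \<pi> $ j + b $ i $ j))"
    by (clarify, rule C_pair_binary_iff)
next
  show "\<forall>(x, \<phi>, \<pi>) \<in> max_throughput_feasible (\<lambda>_ _. dissipation \<alpha>) E b lo hi.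
         \<exists>s. (\<forall>(i, j)\<in>E. s $ i $ j * \<phi> $ i $ j \<ge> 0) \<and>
             (x, \<phi>, \<pi>, s) \<in> relaxed_feasible \<alpha> E b lo hi"
    by (clarify, rule feasible_lifts_to_relaxed)
qed (intro cost_convex relaxed_feasible_mixed_integer_convex[OF assms(1)]
    relaxed_optimal_value_le)+

end
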